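(* Let $K\subset\mathbb R$ be linearly independent over $\mathbb Q$. Then there do not exist infinite sets $S_1,S_2,S_3\subset\mathbb R$ such that $$S_1+S_2+S_3\subset K.$$ In particular, none of the Cantor sets given by the construction described in the context can contain a set of the form $S_1+S_2+S_3$ with each $S_i$ infinite.
   Context: $K\subset\mathbb R$ is linearly independent over $\mathbb Q$ if for any distinct $y_1,\dots,y_m\in K$ and nonzero rationals $q_1,\dots,q_m$ ($m\ge1$) one has $q_1y_1+\cdots+q_my_m\ne0$. $S_1+S_2+S_3=\{s_1+s_2+s_3:s_i\in S_i\}$. The construction of Cantor sets referred to in the claim is the following. Let $(\rho_n)_{n\ge1}$ be a sequence of positive real numbers with $\rho_n\downarrow0$, $\rho_{n+1}<\rho_n/10$ for all $n$, and $2^n(\log(1/\rho_n))^{-s}\to0$ for every $s>0$. Let $L_1,L_2,\dots$ be an enumeration of all linear forms $L(x_1,\dots,x_m)=q_1x_1+\cdots+q_mx_m$ with $m\ge1$ and $q_1,\dots,q_m\in\mathbb Q\setminus\{0\}$, and let $m_k$ be the number of variables of $L_k$. One constructs, for each finite binary word $u$, a nonempty closed interval $I_u\subset(1,2)$ such that: (a) $I_\varnothing\subset(1,2)$ for the empty word $\varnothing$; (b) for $u\in\{0,1\}^n$, $I_{u0}$ and $I_{u1}$ are disjoint closed subintervals of the interior of $I_u$; (c) $\operatorname{diam}(I_u)\le\rho_n$ if $u$ has length $n\ge1$; (d) for every $n\ge1$, every $k\le n$ and all pairwise distinct $u_1,\dots,u_{m_k}\in\{0,1\}^n$, $0\notin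 L_k(I_{u_1}\times\cdots\times I_{u_{m_k}})$. The Cantor set is $K=\bigcap_{n\ge1}\bigcup_{u\in\{0,1\}^n}I_u$; every such $K$ is linearly independent over $\mathbb Q$. *)

theory Defs
  imports "HOL-Analysis.Analysis"
begin

definition rat_independent :: "real set \<Rightarrow> bool" where
  "rat_independent K \<longleftrightarrow> module.independent (\<lambda>(q::rat) (x::real). of_rat q * x) K"

lemma rat_independent_iff:
  "rat_independent K \<longleftrightarrow>
    (\<forall>m\<ge>1. \<forall>(y::nat \<Rightarrow> real) (q::nat \<Rightarrow> rat).
       inj_on y {..<m} \<and> y ` {..<m} \<subseteq> K \<and> (\<forall>i<m. q i \<noteq> 0) \<longrightarrow>
       (\<Sum>i<m. of_rat (q i) * y i) \<noteq> 0)" (is "_ \<longleftrightarrow> ?R")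
proof -
  interpret rv: module "\<lambda>(q::rat) (x::real). of_rat q * x"
    by unfold_locales (simp_all add: of_rat_add of_rat_mult algebra_simps)
  show ?thesis unfolding rat_independent_def
  proof
    assume ind: "rv.independent K"
    show ?R
    proof (intro allI impI notI, elim conjE)
      fix m y and q :: "nat \<Rightarrow> rat"
      assume m: "1 \<le> m" and inj: "inj_on y {..<m}" and sub: "y ` {..<m} \<subseteq> K"
        and q: "\<forall>i<m. q i \<noteq> 0" and z: "(\<Sum>i<m. of_rat (q i) * y i) = 0"
      define u where "u v = q (the_inv_into {..<m} y v)" for v
      have u: "u (y i) = q i" if "i < m" for i
        using that inj by (simp add: u_def the_inv_into_f_f)
      have "(\<Sum>v\<in>y ` {..<m}. of_rat (u v) * v) = 0"
        using z by (simp add: sum.reindex[OF inj] u)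
      then have "u (y 0) = 0"
        using rv.independentD[OF ind _ sub, of u "y 0"] m by auto
      then show False using u[of 0] q m by auto
    qed
  next
    assume R: ?R
    show "rv.independent K"
    proof
      assume "rv.dependent K"
      then obtain t u where t: "finite t" "t \<subseteq> K" "(\<Sum>v\<in>t. of_rat (u v) * v) = 0"
        and ex: "\<exists>v\<in>t. u v \<noteq> 0"
        unfolding rv.dependent_explicit by blast
      define s where "s = {v\<in>t. u v \<noteq> 0}"
      have s: "finite s" "s \<subseteq> K" "s \<noteq> {}" using t ex by (auto simp: s_def)
      have s0: "(\<Sum>v\<in>s. of_rat (u v) * v) = 0"
        using t(3) sum.mono_neutral_right[of t s "\<lambda>v. of_rat (u v) * v"] t(1)
        by (auto simp: s_def)
      obtain y where y: "bij_betw y {..<card s} s"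
        using ex_bij_betw_nat_finite[OF s(1)] by (auto simp: atLeast0LessThan)
      have "(\<Sum>i<card s. of_rat (u (y i)) * y i) = 0"
        using sum.reindex_bij_betw[OF y, of "\<lambda>v. of_rat (u v) * v"] s0 by simp
      moreover have "1 \<le> card s" using s by (simp add: Suc_le_eq card_gt_0_iff)
      moreover have "inj_on y {..<card s}" "y ` {..<card s} \<subseteq> K"
        using y s(2) by (auto simp: bij_betw_def)
      moreover have "\<forall>i<card s. u (y i) \<noteq> 0"
        using bij_betwE[OF y] by (auto simp: s_def)
      ultimately show False using R[rule_format, of "card s" y "\<lambda>i. u (y i)"] by blast
    qed
  qed
qed

text \<open>The form \<open>q\<^sub>1 x\<^sub>1 + \<dots> + q\<^sub>m x\<^sub>m\<close> is represented by the list of its coefficients.\<close>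

definition linear_form :: "rat list \<Rightarrow> real list \<Rightarrow> real" where
  "linear_form qs xs = (\<Sum>i<length qs. of_rat (qs ! i) * xs ! i)"

definition admissible_scales :: "(nat \<Rightarrow> real) \<Rightarrow> bool" where
  "admissible_scales \<rho> \<longleftrightarrow>
     (\<forall>n\<ge>1. 0 < \<rho> n) \<and>
     antimono_on {1..} \<rho> \<and> \<rho> \<longlonglongrightarrow> 0 \<and>
     (\<forall>n\<ge>1. \<rho> (Suc n) < \<rho> n / 10) \<and>
     (\<forall>s>0. (\<lambda>n. 2 ^ n * ln (1 / \<rho> n) powr (- s)) \<longlonglongrightarrow> 0)"

text \<open>Indices start at 1 and the value at 0 is irrelevant; an enumeration may have repetitions.\<close>

definition enumerates_linear_forms :: "(nat \<Rightarrow> rat list) \<Rightarrow> bool" where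
  "enumerates_linear_forms L \<longleftrightarrow> L ` {1..} = {qs. qs \<noteq> [] \<and> 0 \<notin> set qs}"

text \<open>Binary words are boolean lists, so that \<open>u0\<close> and \<open>u1\<close> are \<open>u @ [False]\<close> and
  \<open>u @ [True]\<close>; \<open>listset (map I us)\<close> is the product of the intervals indexed by \<open>us\<close>.\<close>

definition cantor_scheme ::
    "(nat \<Rightarrow> real) \<Rightarrow> (nat \<Rightarrow> rat list) \<Rightarrow> (bool list \<Rightarrow> real set) \<Rightarrow> bool" where
  "cantor_scheme \<rho> L I \<longleftrightarrow>
     (\<forall>u. \<exists>a b. a \<le> b \<and> I u = {a..b}) \<and>
     (\<forall>u. I u \<subseteq> {1<..<2}) \<and>
     (\<forall>u. I (u @ [False]) \<subseteq> interior (I u) \<and> I (u @ [True]) \<subseteq> interior (I u) \<and>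
          I (u @ [False]) \<inter> I (u @ [True]) = {}) \<and>
     (\<forall>u. length u \<ge> 1 \<longrightarrow> diameter (I u) \<le> \<rho> (length u)) \<and>
     (\<forall>n\<ge>1. \<forall>k\<in>{1..n}. \<forall>us.
        length us = length (L k) \<and> distinct us \<and> (\<forall>u\<in>set us. length u = n) \<longrightarrow>
        0 \<notin> linear_form (L k) ` listset (map I us))"

definition cantor_set :: "(bool list \<Rightarrow> real set) \<Rightarrow> real set" where
  "cantor_set I = (\<Inter>n\<in>{1..}. \<Union>u\<in>{u. length u = n}. I u)"

end

theory Submission
  imports Defs
begin

text \<open>If \<open>a \<noteq> a'\<close> and \<open>b \<noteq> b'\<close>, the corners of the parallelogram satisfy
  \<open>(a + b) - (a' + b) - (a + b') + (a' + b') = 0\<close>. The corner \<open>a + b\<close> differs from both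
  corners with coefficient \<open>-1\<close>, so the relation stays nontrivial even when corners
  coincide; hence an independent set contains no sum of two sets with two elements each.
  For the Cantor sets, at a level \<open>n\<close> where \<open>\<rho> n\<close> is below all distances between given
  distinct points, these points lie in intervals with distinct words, so condition (d)
  excludes a rational relation between them.\<close>

lemma rat_independent_not_parallelogram:
  assumes ind: "rat_independent K" and ne: "a \<noteq> a'" "b \<noteq> b'"
    and K: "a + b \<in> K" "a' + b \<in> K" "a + b' \<in> K" "a' + b' \<in> K"
  shows False
proof -
  interpret rv: vector_space "\<lambda>(q::rat) (x::real). of_rat q * x"
    by unfold_locales (simp_all add: of_rat_add of_rat_mult algebra_simps)
  \<comment> \<open>Working with a span rather than an explicit combination makes a coincidence
    \<open>a' + b = a + b'\<close> harmless.\<close>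
  let ?S = "rv.span (K - {a + b})"
  have 1: "a' + b \<in> ?S" and 2: "a + b' \<in> ?S"
    using ne K by (auto intro!: rv.span_base)
  have "a + b \<in> ?S"
  proof (cases "a' + b' = a + b")
    case True
    \<comment> \<open>Here \<open>a' + b'\<close> is the removed point itself, so the relation reads
      \<open>2 * (a + b) = (a' + b) + (a + b')\<close> and has to be halved.\<close>
    have "of_rat (1/2) * ((a' + b) + (a + b')) \<in> ?S"
      by (intro rv.span_scale rv.span_add 1 2)
    also have "of_rat (1/2) * ((a' + b) + (a + b')) = a + b"
      using True by (simp add: of_rat_divide)
    finally show ?thesis .
  next
    case False
    then have "a' + b' \<in> ?S"
      using K by (auto intro!: rv.span_base)
    from rv.span_diff[OF rv.span_add[OF 1 2] this]
    show ?thesis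
      by (simp add: add.commute)
  qed
  then have "rv.dependent K"
    using K(1) by (auto simp: rv.dependent_def)
  then show False
    using ind by (simp add: rat_independent_def)
qed

lemma rat_independent_no_triple_sumset:
  fixes S1 S2 S3 :: "real set"
  assumes "rat_independent K" "infinite S1" "infinite S2" "infinite S3"
  shows "\<not> S1 + S2 + S3 \<subseteq> K"
proof
  assume sub: "S1 + S2 + S3 \<subseteq> K"
  have two: "\<exists>x\<in>S. \<exists>y\<in>S. x \<noteq> y" if "infinite S" for S :: "real set"
    using that by (metis finite.emptyI finite_insert infinite_imp_nonempty insert_iff
        subsetI finite_subset ex_in_conv)
  obtain a a' where a: "a \<in> S1" "a' \<in> S1" "a \<noteq> a'"
    using two assms(2) by blast
  obtain b b' where b: "b \<in> S2" "b' \<in> S2" "b \<noteq> b'"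
    using two assms(3) by blast
  obtain c where c: "c \<in> S3"
    using assms(4) using infinite_imp_nonempty by blast
  \<comment> \<open>Absorbing \<open>c\<close> into the second summand turns the triple sums into
    the corners of a parallelogram.\<close>
  have K: "x + (y + c) \<in> K" if "x \<in> S1" "y \<in> S2" for x y
  proof -
    have "x + y + c \<in> S1 + S2 + S3"
      using that c by (intro set_plus_intro)
    then show ?thesis
      using sub by (auto simp: add.assoc)
  qed
  show False
    by (rule rat_independent_not_parallelogram[OF assms(1), of a a' "b + c" "b' + c"])
      (use a b K in auto)
qed

text \<open>\<open>listset\<close> is defined by recursion on the list, so indexwise membership is
  passed through \<open>list_all2\<close> and its induction rule.\<close>

lemma in_listsetI:
  assumes "length xs = length As" "\<And>i. i < length As \<Longrightarrow> xs ! i \<in> As ! i"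
  shows "xs \<in> listset As"
proof -
  have "list_all2 (\<in>) xs As"
    using assms by (simp add: list_all2_conv_all_nth)
  then show ?thesis
    by induction (auto simp: set_Cons_def)
qed

lemma rat_independent_cantor_set:
  assumes scales: "admissible_scales \<rho>" and enum: "enumerates_linear_forms L"
    and scheme: "cantor_scheme \<rho> L I"
  shows "rat_independent (cantor_set I)"
  unfolding rat_independent_iff
proof (intro allI impI notI, elim conjE)
  fix m and y :: "nat \<Rightarrow> real" and q :: "nat \<Rightarrow> rat"
  assume m: "1 \<le> m" and inj: "inj_on y {..<m}" and sub: "y ` {..<m} \<subseteq> cantor_set I"
    and q: "\<forall>i<m. q i \<noteq> 0" and z: "(\<Sum>i<m. of_rat (q i) * y i) = 0"
  have "map q [0..<m] \<in> L ` {1..}"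
    using enum m q by (auto simp: enumerates_linear_forms_def)
  then obtain k where k: "k \<ge> 1" "L k = map q [0..<m]"
    by auto
  have sep: "\<forall>\<^sub>F n in sequentially. \<rho> n < dist (y i) (y j)"
    if "i < m" "j < m" "i \<noteq> j" for i j
  proof -
    have "\<rho> \<longlonglongrightarrow> 0"
      using scales by (simp add: admissible_scales_def)
    moreover have "0 < dist (y i) (y j)"
      using inj that by (auto dest: inj_onD)
    ultimately show ?thesis
      by (rule order_tendstoD)
  qed
  have "\<forall>\<^sub>F n in sequentially. \<forall>i\<in>{..<m}. \<forall>j\<in>{..<m}-{i}. \<rho> n < dist (y i) (y j)"
    by (intro eventually_ball_finite ballI sep) auto
  \<comment> \<open>At level \<open>n\<close> condition (d) covers only the forms with index at most
    \<open>n\<close>, hence \<open>n \<ge> k\<close>; this also gives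
    \<open>n \<ge> 1\<close>.\<close>
  then have "\<forall>\<^sub>F n in sequentially. n \<ge> k \<and>
      (\<forall>i\<in>{..<m}. \<forall>j\<in>{..<m}-{i}. \<rho> n < dist (y i) (y j))"
    using eventually_ge_at_top[of k] by eventually_elim auto
  then obtain n where n: "n \<ge> k"
    and sep_n: "\<And>i j. i < m \<Longrightarrow> j < m \<Longrightarrow> i \<noteq> j \<Longrightarrow> \<rho> n < dist (y i) (y j)"
    unfolding eventually_sequentially by force
  have "\<exists>u. length u = n \<and> y i \<in> I u" if "i < m" for i
    using sub that n k by (force simp: cantor_set_def)
  then obtain w where w: "\<And>i. i < m \<Longrightarrow> length (w i) = n"
      "\<And>i. i < m \<Longrightarrow> y i \<in> I (w i)"
    by metis
  have "inj_on w {..<m}"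
  proof (rule inj_onI, rule ccontr)
    fix i j assume ij: "i \<in> {..<m}" "j \<in> {..<m}" "w i = w j" "i \<noteq> j"
    \<comment> \<open>The diameter is a supremum, which dominates the distances only when they are
      bounded.\<close>
    have "bounded (I (w i))"
      using scheme unfolding cantor_scheme_def by (metis bounded_closed_interval)
    then have "dist (y i) (y j) \<le> diameter (I (w i))"
      using ij w(2)[of i] w(2)[of j] by (intro diameter_bounded_bound) auto
    also have "\<dots> \<le> \<rho> n"
      using scheme w(1)[of i] ij n k by (auto simp: cantor_scheme_def)
    finally show False
      using sep_n[of i j] ij by auto
  qed
  then have "distinct (map w [0..<m])"
    by (simp add: distinct_map atLeast0LessThan)
  \<comment> \<open>This is condition (d) for the words \<open>w i\<close>; the point
    \<open>map y [0..<m]\<close> of the product will contradict it.\<close>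
  then have "0 \<notin> linear_form (L k) ` listset (map I (map w [0..<m]))"
    using scheme k n w(1) unfolding cantor_scheme_def
    by (elim conjE allE[of _ n] impE ballE[of _ _ k] allE[of _ "map w [0..<m]"]) auto
  moreover have "map y [0..<m] \<in> listset (map I (map w [0..<m]))"
    using w(2) by (intro in_listsetI) auto
  moreover have "linear_form (L k) (map y [0..<m]) = 0"
    using z by (simp add: linear_form_def k)
  ultimately show False
    by (metis image_eqI)
qed

theorem proposition3p4:
  shows "(\<forall>K :: real set. rat_independent K \<longrightarrow>
            \<not> (\<exists>S1 S2 S3 :: real set. infinite S1 \<and> infinite S2 \<and> infinite S3 \<and>
                 S1 + S2 + S3 \<subseteq> K)) \<and>
         (\<forall>\<rho> L I. admissible_scales \<rho> \<and> enumerates_linear_forms L \<and> cantor_scheme \<rho> L I \<longrightarrow>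
            \<not> (\<exists>S1 S2 S3 :: real set. infinite S1 \<and> infinite S2 \<and> infinite S3 \<and>
                 S1 + S2 + S3 \<subseteq> cantor_set I))"
  using rat_independent_no_triple_sumset rat_independent_cantor_set by blast

end
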